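(* Let $A$ be a right-symmetric algebra and $M$ an $A$-module. Let $D_i:C^{*+1}_{rsym}(A,M)\to C^{*+1}_{rsym}(A,M)$, $i=1,2,\ldots$, be the linear operators, $D_i:C^k_{rsym}(A,M)\to C^{k+1}_{rsym}(A,M)$, given by $$D_i\psi(a_0,a_1,\ldots,a_k)=a_0\circ\psi(a_i,a_1,\ldots,\widehat{a_i},\ldots,a_k)-\psi(a_0\circ a_i,a_1,\ldots,\widehat{a_i},\ldots,a_k)$$ $$+\psi(a_0,a_1,\ldots,\widehat{a_i},\ldots,a_k)\circ a_i+\sum_{i<j}\psi(a_0,a_1,\ldots,\widehat{a_i},\ldots,a_{j-1},[a_i,a_j],\ldots,a_k)$$ for $i\le k$, and $D_i\psi=0$ for $i>k$. Then the set of endomorphisms $\{D_i,\ i=1,2,\ldots\}$ endows $C^{*+1}_{rsym}(A,M)=\bigoplus_{k>0}C^k_{rsym}(A,M)$ with a pre-simplicial structure: $$D_jD_i=D_iD_{j-1},\qquad i<j.$$ In particular, $d_{rsym}=-\sum_i(-1)^iD_i$ is a coboundary operator on $C^{*+1}_{rsym}(A,M)$: $d_{rsym}^2=0$.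
   Context: A right-symmetric algebra over a field $\mathcal K$ is a vector space $A$ with bilinear product $\circ$ satisfying $(a\circ b)\circ c-a\circ(b\circ c)=(a\circ c)\circ b-a\circ(c\circ b)$; $[a,b]=a\circ b-b\circ a$. An $A$-module is a vector space $M$ with bilinear right action $(m,a)\mapsto m\circ a$ and left action $(a,m)\mapsto a\circ m$ such that $m\circ[a,b]-(m\circ a)\circ b+(m\circ b)\circ a=0$ and $(a\circ m)\circ b-a\circ(m\circ b)-(a\circ b)\circ m+a\circ(b\circ m)=0$ for all $a,b\in A$, $m\in M$. For $k\ge 0$, $C^{k+1}_{rsym}(A,M)=\mathrm{Hom}(A\otimes\wedge^kA,M)$, and $C^{*+1}_{rsym}(A,M)=\bigoplus_{k\ge0}C^{k+1}_{rsym}(A,M)$. A hat means that the element is omitted.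
   Formalization: A single D_i need not map C_rsym to itself (A=M=K, ψ(a_0,a_1)=a_0a_1 gives D_1ψ=a_0a_1a_2, not skew), so the D_i and D_jD_i=D_iD_{j-1} are stated on the larger space ⊕Hom(A⊗A^{⊗k},M), containing C_rsym; d_rsym preserves C_rsym and d_rsym²=0 there. *)

theory Defs
  imports Complex_Main "HOL-Library.Function_Algebras"
begin

locale right_symmetric_algebra = vector_space scaleA
  for scaleA :: "'k::field \<Rightarrow> 'a::ab_group_add \<Rightarrow> 'a" +
  fixes mul :: "'a \<Rightarrow> 'a \<Rightarrow> 'a"
  assumes mul_linear_left: "\<And>b. Vector_Spaces.linear scaleA scaleA (\<lambda>a. mul a b)"
    and mul_linear_right: "\<And>a. Vector_Spaces.linear scaleA scaleA (\<lambda>b. mul a b)"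
    and right_symmetric:
      "\<And>a b c. mul (mul a b) c - mul a (mul b c) = mul (mul a c) b - mul a (mul c b)"

definition bracket :: "('a::ab_group_add \<Rightarrow> 'a \<Rightarrow> 'a) \<Rightarrow> 'a \<Rightarrow> 'a \<Rightarrow> 'a" where
  "bracket mul a b = mul a b - mul b a"

locale right_symmetric_module =
  right_symmetric_algebra scaleA mul + M: vector_space scaleM
  for scaleA :: "'k::field \<Rightarrow> 'a::ab_group_add \<Rightarrow> 'a"
    and mul :: "'a \<Rightarrow> 'a \<Rightarrow> 'a"
    and scaleM :: "'k \<Rightarrow> 'm::ab_group_add \<Rightarrow> 'm" +
  fixes lact :: "'a \<Rightarrow> 'm \<Rightarrow> 'm"
    and ract :: "'m \<Rightarrow> 'a \<Rightarrow> 'm"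
  assumes lact_linear_left: "\<And>m. Vector_Spaces.linear scaleA scaleM (\<lambda>a. lact a m)"
    and lact_linear_right: "\<And>a. Vector_Spaces.linear scaleM scaleM (\<lambda>m. lact a m)"
    and ract_linear_left: "\<And>a. Vector_Spaces.linear scaleM scaleM (\<lambda>m. ract m a)"
    and ract_linear_right: "\<And>m. Vector_Spaces.linear scaleA scaleM (\<lambda>a. ract m a)"
    and ract_bracket:
      "\<And>m a b. ract m (bracket mul a b) - ract (ract m a) b + ract (ract m b) a = 0"
    and lact_ract:
      "\<And>a m b. ract (lact a m) b - lact a (ract m b) - lact (mul a b) m + lact a (lact b m) = 0"

text \<open>
  A cochain of degree \<open>n = k + 1\<close> is a function on argument lists
  \<open>[a\<^sub>0, a\<^sub>1, \<dots>, a\<^sub>k]\<close> of length \<open>n\<close>, set to \<open>0\<close> on lists of any other length so that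
  equality of cochains is equality of functions.  The space \<open>tensor_cochains\<close> in degree
  \<open>k + 1\<close> is \<open>Hom (A \<otimes> A\<^sup>\<otimes>\<^sup>k, M)\<close>; \<open>rsym_cochains\<close> is its subspace
  \<open>Hom (A \<otimes> \<Lambda>\<^sup>k A, M)\<close>, cut out by vanishing whenever two of \<open>a\<^sub>1, \<dots>, a\<^sub>k\<close> are equal
  (correct in every characteristic).
\<close>

definition tensor_cochains ::
    "('k::field \<Rightarrow> 'a::ab_group_add \<Rightarrow> 'a) \<Rightarrow> ('k \<Rightarrow> 'm::ab_group_add \<Rightarrow> 'm) \<Rightarrow>
     nat \<Rightarrow> ('a list \<Rightarrow> 'm) set" where
  "tensor_cochains scaleA scaleM n =
     {\<psi>. (\<forall>xs. length xs = n \<longrightarrow>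
            (\<forall>p<n. Vector_Spaces.linear scaleA scaleM (\<lambda>x. \<psi> (xs[p := x])))) \<and>
         (\<forall>xs. length xs \<noteq> n \<longrightarrow> \<psi> xs = 0)}"

definition rsym_cochains ::
    "('k::field \<Rightarrow> 'a::ab_group_add \<Rightarrow> 'a) \<Rightarrow> ('k \<Rightarrow> 'm::ab_group_add \<Rightarrow> 'm) \<Rightarrow>
     nat \<Rightarrow> ('a list \<Rightarrow> 'm) set" where
  "rsym_cochains scaleA scaleM n =
     {\<psi> \<in> tensor_cochains scaleA scaleM n.
        \<forall>xs p q. length xs = n \<and> 1 \<le> p \<and> p < q \<and> q < n \<and> xs ! p = xs ! q \<longrightarrow> \<psi> xs = 0}"

text \<open>
  Elements of the direct sum over all degrees \<open>n \<ge> 1\<close> are finitely supported families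
  \<open>c\<close>, with \<open>c n\<close> the component in degree \<open>n\<close>; degree \<open>0\<close> does not occur.
\<close>

definition direct_sum :: "(nat \<Rightarrow> 'c::zero set) \<Rightarrow> (nat \<Rightarrow> 'c) set" where
  "direct_sum C = {c. c 0 = 0 \<and> (\<forall>n\<ge>1. c n \<in> C n) \<and> finite {n. c n \<noteq> 0}}"

definition homogeneous :: "(nat \<Rightarrow> 'c::zero set) \<Rightarrow> nat \<Rightarrow> (nat \<Rightarrow> 'c) set" where
  "homogeneous C n = {c. c n \<in> C n \<and> (\<forall>m. m \<noteq> n \<longrightarrow> c m = 0)}"

definition scale_family ::
    "('k \<Rightarrow> 'm \<Rightarrow> 'm) \<Rightarrow> 'k \<Rightarrow> (nat \<Rightarrow> 'a list \<Rightarrow> 'm) \<Rightarrow> nat \<Rightarrow> 'a list \<Rightarrow> 'm" where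
  "scale_family scaleM r c = (\<lambda>n xs. scaleM r (c n xs))"

definition omit :: "nat \<Rightarrow> 'a list \<Rightarrow> 'a list" where
  "omit i xs = take i xs @ drop (Suc i) xs"

text \<open>
  The component of \<open>D\<^sub>i c\<close> in degree \<open>k + 1\<close> is \<open>D\<^sub>i\<close> applied to the component of \<open>c\<close> in
  degree \<open>k\<close>, evaluated on \<open>[a\<^sub>0, \<dots>, a\<^sub>k]\<close>; it is \<open>0\<close> for \<open>i > k\<close>.  Only indices
  \<open>i \<ge> 1\<close> are meaningful.

  For \<open>\<psi>\<close> in \<open>Hom (A \<otimes> \<Lambda>\<^sup>k\<^sup>-\<^sup>1 A, M)\<close> a single \<open>D\<^sub>i \<psi>\<close> need not be skew-symmetric in
  \<open>a\<^sub>1, \<dots>, a\<^sub>k\<close>: for \<open>A = M = \<K>\<close> with the field product and \<open>\<psi>(a\<^sub>0, a\<^sub>1) = a\<^sub>0 a\<^sub>1\<close> one gets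
  \<open>D\<^sub>1 \<psi> (a\<^sub>0, a\<^sub>1, a\<^sub>2) = a\<^sub>0 a\<^sub>1 a\<^sub>2\<close>.  The individual \<open>D\<^sub>i\<close> are therefore endomorphisms of
  the direct sum of the \<open>tensor_cochains\<close>, and only their alternating sum preserves the
  direct sum of the \<open>rsym_cochains\<close>.
\<close>

definition rsym_D ::
    "('a::ab_group_add \<Rightarrow> 'a \<Rightarrow> 'a) \<Rightarrow> ('a \<Rightarrow> 'm::ab_group_add \<Rightarrow> 'm) \<Rightarrow> ('m \<Rightarrow> 'a \<Rightarrow> 'm) \<Rightarrow>
     nat \<Rightarrow> (nat \<Rightarrow> 'a list \<Rightarrow> 'm) \<Rightarrow> nat \<Rightarrow> 'a list \<Rightarrow> 'm" where
  "rsym_D mul lact ract i c n xs =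
     (case n of
        0 \<Rightarrow> 0
      | Suc k \<Rightarrow>
          if i \<le> k \<and> length xs = Suc k then
            lact (xs ! 0) (c k (omit i (xs[0 := xs ! i])))
            - c k (omit i (xs[0 := mul (xs ! 0) (xs ! i)]))
            + ract (c k (omit i xs)) (xs ! i)
            + (\<Sum>j\<in>{i<..k}. c k (omit i (xs[j := bracket mul (xs ! i) (xs ! j)])))
          else 0)"

text \<open>
  In degree \<open>n\<close> the sum over all \<open>i \<ge> 1\<close> reduces to \<open>i < n\<close>, the other terms being \<open>0\<close>.
\<close>

definition rsym_d ::
    "('k::field \<Rightarrow> 'm::ab_group_add \<Rightarrow> 'm) \<Rightarrow> ('a::ab_group_add \<Rightarrow> 'a \<Rightarrow> 'a) \<Rightarrow>
     ('a \<Rightarrow> 'm \<Rightarrow> 'm) \<Rightarrow> ('m \<Rightarrow> 'a \<Rightarrow> 'm) \<Rightarrow>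
     (nat \<Rightarrow> 'a list \<Rightarrow> 'm) \<Rightarrow> nat \<Rightarrow> 'a list \<Rightarrow> 'm" where
  "rsym_d scaleM mul lact ract c n xs =
     - (\<Sum>i\<in>{1..<n}. scaleM ((-1) ^ i) (rsym_D mul lact ract i c n xs))"

end

theory Submission
  imports Defs
begin

text \<open>
  For \<open>x \<in> A\<close> and a position \<open>i \<ge> 1\<close> let \<open>E\<^sub>i(x)\<close> act on functions of a list \<open>ys\<close> by
  a \<^emph>\<open>head\<close> part, which changes only the entry \<open>ys\<^sub>0\<close>, and a \<^emph>\<open>tail\<close> part, which replaces in turn
  each entry \<open>ys\<^sub>l\<close>, \<open>l \<ge> i\<close>, by \<open>[x, ys\<^sub>l]\<close>. Deleting \<open>a\<^sub>i\<close> from the list of arguments shows that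
  \<open>(D\<^sub>i \<psi>)(as) = (E\<^sub>i(a\<^sub>i) \<psi>)(as without a\<^sub>i)\<close> (\<open>rsym_D_eq\<close>).

  On lists from which both \<open>x = a\<^sub>i\<close> and \<open>y = a\<^sub>m\<^sub>+\<^sub>1\<close> are deleted, \<open>i \<le> m\<close>, the composite
  \<open>D\<^sub>m\<^sub>+\<^sub>1 D\<^sub>i\<close> is \<open>E\<^sub>m(y) E\<^sub>i(x)\<close>. In \<open>D\<^sub>i D\<^sub>m\<close> the element \<open>y\<close> is still an argument when \<open>x\<close> acts, so
  that, besides \<open>E\<^sub>i(x) E\<^sub>m(y)\<close>, a term \<open>E\<^sub>m([x, y])\<close> occurs. The relation \<open>D\<^sub>m\<^sub>+\<^sub>1 D\<^sub>i = D\<^sub>i D\<^sub>m\<close> is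
  therefore the commutator formula \<open>E\<^sub>m(y) E\<^sub>i(x) - E\<^sub>i(x) E\<^sub>m(y) = E\<^sub>m([x, y])\<close>
  (\<open>slot_action_commutator\<close>). Head and tail parts commute since they touch different slots; for
  the tails the formula is the Jacobi identity, and for the heads it is exactly what
  right-symmetry and the two module axioms provide.

  That \<open>d\<close> preserves skew-symmetry needs to be tested only on equal neighbours
  \<open>a\<^sub>p = a\<^sub>p\<^sub>+\<^sub>1\<close> (\<open>alternating_if_adjacent\<close>). There the terms with \<open>i \<noteq> p, p + 1\<close> vanish one by one,
  and those with \<open>i = p\<close> and \<open>i = p + 1\<close> agree and enter with opposite signs. Finally
  \<open>d\<^sup>2 = 0\<close> follows from the relations between the \<open>D\<^sub>i\<close> by the usual pairing of the terms
  \<open>i < j\<close> with the terms \<open>i \<ge> j\<close>.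
\<close>

section \<open>Deleting entries of lists\<close>

lemma length_omit [simp]: "i < length xs \<Longrightarrow> length (omit i xs) = length xs - 1"
  by (auto simp: omit_def)

lemma nth_omit:
  "i < length xs \<Longrightarrow> p < length xs - 1 \<Longrightarrow> omit i xs ! p = (if p < i then xs ! p else xs ! Suc p)"
  by (auto simp: omit_def nth_append min_def)

lemma omit_update_below:
  "p < i \<Longrightarrow> i < length xs \<Longrightarrow> omit i (xs[p := v]) = (omit i xs)[p := v]"
  by (auto intro!: nth_equalityI simp: nth_omit nth_list_update)

lemma omit_update_above:
  "i < p \<Longrightarrow> p < length xs \<Longrightarrow> omit i (xs[p := v]) = (omit i xs)[p - 1 := v]"
  by (rule nth_equalityI) (auto simp: nth_omit nth_list_update)

lemma omit_update_same: "omit i (xs[i := v]) = omit i xs"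
  by (simp add: omit_def)

lemma omit_omit:
  "i < j \<Longrightarrow> j < length xs \<Longrightarrow> omit i (omit j xs) = omit (j - 1) (omit i xs)"
  by (rule nth_equalityI) (auto simp: nth_omit)

lemma omit_adjacent_eq:
  "Suc p < length xs \<Longrightarrow> xs ! p = xs ! Suc p \<Longrightarrow> omit p xs = omit (Suc p) xs"
  by (rule nth_equalityI) (auto simp: nth_omit less_Suc_eq)

section \<open>Linear maps, the algebra and its module\<close>

lemma linear_comp:
  "Vector_Spaces.linear s1 s2 f \<Longrightarrow> Vector_Spaces.linear s2 s3 g
     \<Longrightarrow> Vector_Spaces.linear s1 s3 (\<lambda>x. g (f x))"
  using Vector_Spaces.linear_compose[of s1 s2 f s3 g] by (simp add: o_def)

lemma sum_fun_apply: "(\<Sum>i\<in>A. f i) x = (\<Sum>i\<in>A. f i x)"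
  by (induction A rule: infinite_finite_induct) auto

context right_symmetric_module
begin

abbreviation br where "br \<equiv> bracket mul"

sublocale AA: vector_space_pair scaleA scaleA by unfold_locales
sublocale AM: vector_space_pair scaleA scaleM by unfold_locales
sublocale MM: vector_space_pair scaleM scaleM by unfold_locales

lemmas mul_diff_left = AA.linear_diff[OF mul_linear_left]
  and mul_diff_right = AA.linear_diff[OF mul_linear_right]

lemmas lact_add = MM.linear_add[OF lact_linear_right]
  and lact_diff = MM.linear_diff[OF lact_linear_right]
  and lact_zero = MM.linear_0[OF lact_linear_right]
  and lact_sum = MM.linear_sum[OF lact_linear_right]
  and lact_scale = MM.linear_scale[OF lact_linear_right]

lemmas ract_add = MM.linear_add[OF ract_linear_left]
  and ract_diff = MM.linear_diff[OF ract_linear_left]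
  and ract_zero = MM.linear_0[OF ract_linear_left]
  and ract_sum = MM.linear_sum[OF ract_linear_left]
  and ract_scale = MM.linear_scale[OF ract_linear_left]

lemma br_self [simp]: "br a a = 0"
  by (simp add: bracket_def)

lemma linear_br_right: "Vector_Spaces.linear scaleA scaleA (\<lambda>b. br a b)"
  unfolding bracket_def
  by (intro AA.linear_compose_sub mul_linear_left mul_linear_right)

lemma linear_br_left: "Vector_Spaces.linear scaleA scaleA (\<lambda>a. br a b)"
  unfolding bracket_def
  by (intro AA.linear_compose_sub mul_linear_left mul_linear_right)

text \<open>
  Expanded, the difference of the two sides is an alternating sum of associators, and these
  cancel in pairs by their symmetry in the last two arguments.
\<close>

lemma jacobi: "br x (br y z) - br y (br x z) = br (br x y) z"
proof -
  have rs: "mul a (mul b c) + mul (mul a c) b = mul a (mul c b) + mul (mul a b) c" for a b c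
    using right_symmetric[of a b c] by (simp add: algebra_simps)
  have "(mul x (mul y z) + mul (mul x z) y) + (mul y (mul z x) + mul (mul y x) z)
          + (mul z (mul x y) + mul (mul z y) x)
      = (mul x (mul z y) + mul (mul x y) z) + (mul y (mul x z) + mul (mul y z) x)
          + (mul z (mul y x) + mul (mul z x) y)"
    by (simp only: rs[of x y z] rs[of y z x] rs[of z x y])
  then show ?thesis
    by (simp add: bracket_def mul_diff_left mul_diff_right algebra_simps)
qed

abbreviation tensors where "tensors \<equiv> tensor_cochains scaleA scaleM"
abbreviation alternating where "alternating \<equiv> rsym_cochains scaleA scaleM"

lemma tensors_linear:
  "\<psi> \<in> tensors n \<Longrightarrow> length xs = n \<Longrightarrow> p < n \<Longrightarrow>
     Vector_Spaces.linear scaleA scaleM (\<lambda>x. \<psi> (xs[p := x]))"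
  by (simp add: tensor_cochains_def)

lemma tensors_outside: "\<psi> \<in> tensors n \<Longrightarrow> length xs \<noteq> n \<Longrightarrow> \<psi> xs = 0"
  by (simp add: tensor_cochains_def)

section \<open>Actions of one element on the slots of a cochain\<close>

text \<open>
  The head collects those terms of \<open>D\<^sub>i\<close> that touch only the first argument, the tail those that
  bracket a later one; \<open>x\<close> stands for the deleted argument \<open>a\<^sub>i\<close> and \<open>ys\<close> for the remaining
  ones. With \<open>x\<close> detached from the list, composites of the \<open>D\<^sub>i\<close> become composites of operators
  in a fixed degree.
\<close>

definition head_action :: "'a \<Rightarrow> ('a list \<Rightarrow> 'm) \<Rightarrow> 'a list \<Rightarrow> 'm" where
  "head_action x \<psi> ys =
     lact (ys ! 0) (\<psi> (ys[0 := x])) - \<psi> (ys[0 := mul (ys ! 0) x]) + ract (\<psi> ys) x"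

definition tail_action :: "nat \<Rightarrow> 'a \<Rightarrow> ('a list \<Rightarrow> 'm) \<Rightarrow> 'a list \<Rightarrow> 'm" where
  "tail_action i x \<psi> ys = (\<Sum>l\<in>{i..<length ys}. \<psi> (ys[l := br x (ys ! l)]))"

definition slot_action :: "nat \<Rightarrow> 'a \<Rightarrow> ('a list \<Rightarrow> 'm) \<Rightarrow> 'a list \<Rightarrow> 'm" where
  "slot_action i x \<psi> ys = head_action x \<psi> ys + tail_action i x \<psi> ys"

lemma head_action_add:
  "head_action x (\<lambda>ys. \<phi> ys + \<psi> ys) ys = head_action x \<phi> ys + head_action x \<psi> ys"
  by (simp add: head_action_def lact_add ract_add)

lemma tail_action_add:
  "tail_action i x (\<lambda>ys. \<phi> ys + \<psi> ys) ys = tail_action i x \<phi> ys + tail_action i x \<psi> ys"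
  by (simp add: tail_action_def sum.distrib)

text \<open>The tail part never touches the slot \<open>0\<close>, because \<open>i \<ge> 1\<close>.\<close>

lemma head_tail_commute:
  assumes "1 \<le> i"
  shows "head_action x (tail_action i y \<psi>) zs = tail_action i y (head_action x \<psi>) zs"
proof -
  have "zs[l := v, 0 := u] = zs[0 := u, l := v]" if "l \<in> {i..<length zs}" for l u v
    using that assms by (simp add: list_update_swap)
  with assms show ?thesis
    by (simp add: head_action_def tail_action_def lact_sum ract_sum sum.distrib sum_subtractf)
qed

text \<open>
  Write \<open>f a\<close> for the value of \<open>\<psi>\<close> with \<open>a\<close> in its slot \<open>0\<close>. In the double action the
  terms \<open>(a \<circ> f x) \<circ> y\<close> are rewritten by the left-right module axiom; then all mixed terms are
  symmetric in \<open>x, y\<close> and disappear from the commutator. What remains is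
  \<open>a \<circ> f [x, y]\<close>, the term \<open>(f a) \<circ> [x, y]\<close> from the right module axiom, and
  \<open>f ((a \<circ> y) \<circ> x) - f ((a \<circ> x) \<circ> y) = - f (a \<circ> [x, y])\<close> from right-symmetry.
\<close>

lemma head_action_commutator:
  assumes "\<psi> \<in> tensors n" "length zs = n" "1 \<le> n"
  shows "head_action y (head_action x \<psi>) zs
           = head_action x (head_action y \<psi>) zs + head_action (br x y) \<psi> zs"
proof -
  define f where "f = (\<lambda>a. \<psi> (zs[0 := a]))"
  define a where "a = zs ! 0"
  have lin: "Vector_Spaces.linear scaleA scaleM f"
    unfolding f_def using tensors_linear[OF assms(1,2)] assms(3) by simp
  note fd = AM.linear_diff[OF lin]
  have f: "\<psi> zs = f a" by (simp add: f_def a_def)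
  have expand: "head_action u (head_action v \<psi>) zs =
      lact a (lact u (f v) - f (mul u v) + ract (f u) v)
      - (lact (mul a u) (f v) - f (mul (mul a u) v) + ract (f (mul a u)) v)
      + ract (lact a (f v) - f (mul a v) + ract (f a) v) u" for u v
    using assms by (simp add: head_action_def f_def a_def)
  have single: "head_action u \<psi> zs = lact a (f u) - f (mul a u) + ract (f a) u" for u
    by (simp add: head_action_def f_def a_def)
  have act: "ract (lact a (f v)) u = lact a (ract (f v) u) + lact (mul a u) (f v) - lact a (lact u (f v))"
    for u v using lact_ract[of a "f v" u] by (simp add: algebra_simps)
  have rb: "ract (f a) (br x y) = ract (ract (f a) x) y - ract (ract (f a) y) x"
    using ract_bracket[of "f a" x y] by (simp add: algebra_simps)
  have "f (mul (mul a y) x) - f (mul (mul a x) y) = f (mul (mul a y) x - mul (mul a x) y)"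
    by (simp add: fd)
  also have "mul (mul a y) x - mul (mul a x) y = mul a (mul y x) - mul a (mul x y)"
    using right_symmetric[of a x y] by (simp add: algebra_simps)
  also have "\<dots> = - mul a (br x y)"
    by (simp add: bracket_def mul_diff_right)
  finally have m: "f (mul (mul a y) x) = f (mul (mul a x) y) - f (mul a (br x y))"
    using AM.linear_neg[OF lin] by (simp add: algebra_simps)
  have fb: "f (br x y) = f (mul x y) - f (mul y x)"
    by (simp add: bracket_def fd)
  show ?thesis
    unfolding expand single
    by (simp add: lact_add lact_diff ract_add ract_diff act rb m fb algebra_simps)
qed

text \<open>
  Replacements in two different slots commute, so only the diagonal terms contribute, and on
  them the formula is the Jacobi identity. The diagonal reaches only over the slots \<open>l \<ge> m\<close>
  common to both tails, whence the index \<open>m\<close> on the right.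
\<close>

lemma tail_action_commutator:
  assumes "\<psi> \<in> tensors n" "length zs = n" "i \<le> m"
  shows "tail_action m y (tail_action i x \<psi>) zs
           = tail_action i x (tail_action m y \<psi>) zs + tail_action m (br x y) \<psi> zs"
proof -
  define F where "F u v l r = \<psi> (zs[l := br u (zs ! l), r := br v (zs[l := br u (zs ! l)] ! r)])"
    for u v l r
  have diag: "F y x l r - F x y r l = (if l = r then \<psi> (zs[l := br (br x y) (zs ! l)]) else 0)"
    if "l < n" "r < n" for l r
  proof (cases "l = r")
    case True
    then show ?thesis
      using that assms(2) AM.linear_diff[OF tensors_linear[OF assms(1,2) that(1)]]
      by (simp add: F_def flip: jacobi)
  next
    case False
    then show ?thesis by (simp add: F_def list_update_swap[of l r])
  qed
  have "tail_action m y (tail_action i x \<psi>) zs - tail_action i x (tail_action m y \<psi>) zs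
      = (\<Sum>l\<in>{m..<n}. \<Sum>r\<in>{i..<n}. F y x l r) - (\<Sum>l\<in>{m..<n}. \<Sum>r\<in>{i..<n}. F x y r l)"
    using assms(2) by (simp add: tail_action_def F_def sum.swap[of _ "{m..<n}"])
  also have "\<dots> = (\<Sum>l\<in>{m..<n}. \<Sum>r\<in>{i..<n}. F y x l r - F x y r l)"
    by (simp add: sum_subtractf)
  also have "\<dots> = (\<Sum>l\<in>{m..<n}. \<Sum>r\<in>{i..<n}. if l = r then \<psi> (zs[l := br (br x y) (zs ! l)]) else 0)"
    by (intro sum.cong refl diag) auto
  also have "\<dots> = tail_action m (br x y) \<psi> zs"
    using assms(2,3) by (auto simp: tail_action_def sum.delta' intro!: sum.cong)
  finally show ?thesis by (simp add: algebra_simps)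
qed

lemma slot_action_commutator:
  assumes "\<psi> \<in> tensors n" "length zs = n" "1 \<le> n" "1 \<le> i" "i \<le> m"
  shows "slot_action m y (slot_action i x \<psi>) zs
           = slot_action i x (slot_action m y \<psi>) zs + slot_action m (br x y) \<psi> zs"
proof -
  have "1 \<le> m" using assms by simp
  have *: "slot_action k v (slot_action l u \<psi>) zs =
      head_action v (head_action u \<psi>) zs + tail_action l u (head_action v \<psi>) zs
      + tail_action k v (head_action u \<psi>) zs + tail_action k v (tail_action l u \<psi>) zs"
    if "1 \<le> l" for k l u v
    using head_tail_commute[OF that]
    by (simp add: slot_action_def[abs_def] head_action_add tail_action_add)
  show ?thesis
    using *[OF assms(4), of m y x] *[OF \<open>1 \<le> m\<close>, of i x y]
      head_action_commutator[OF assms(1-3), of y x]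
      tail_action_commutator[OF assms(1,2,5), of y x]
    by (simp add: slot_action_def[of m "br x y"])
qed

section \<open>The pre-simplicial relations\<close>

text \<open>
  After \<open>a\<^sub>i\<close> is deleted the arguments behind it move down by one, so the sum over \<open>j > i\<close>
  becomes the tail starting at position \<open>i\<close>.
\<close>

lemma rsym_D_eq:
  assumes "1 \<le> i"
  shows "rsym_D mul lact ract i c (Suc k) xs =
    (if i \<le> k \<and> length xs = Suc k then slot_action i (xs ! i) (c k) (omit i xs) else 0)"
proof (cases "i \<le> k \<and> length xs = Suc k")
  case True
  have "(\<Sum>j\<in>{i<..k}. c k (omit i (xs[j := br (xs ! i) (xs ! j)])))
      = (\<Sum>l\<in>{i..<k}. c k ((omit i xs)[l := br (xs ! i) (omit i xs ! l)]))"
    using True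
    by (intro sum.reindex_bij_witness[of _ Suc "\<lambda>j. j - 1"])
       (auto simp: omit_update_above nth_omit)
  with True assms show ?thesis
    by (simp add: rsym_D_def slot_action_def head_action_def tail_action_def
        omit_update_below nth_omit)
qed (auto simp: rsym_D_def)

lemma rsym_D_0 [simp]: "rsym_D mul lact ract i c 0 = 0"
  by (simp add: rsym_D_def fun_eq_iff)

lemma slot_action_zero [simp]: "slot_action i x 0 = 0"
  by (simp add: slot_action_def head_action_def tail_action_def fun_eq_iff lact_zero ract_zero)

text \<open>
  On the left, the tail of \<open>y\<close> consists of slots behind the one that holds \<open>x\<close>, so \<open>y\<close> leaves
  \<open>x\<close> alone. On the right, the tail of \<open>x\<close> runs also over the slot \<open>m\<close> that holds \<open>y\<close>; there it turns
  \<open>y\<close> into \<open>[x, y]\<close>, and this term compensates the commutator.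
\<close>

lemma rsym_D_commute:
  assumes im: "1 \<le> i" "i \<le> m" and c: "\<And>n. 1 \<le> n \<Longrightarrow> c n \<in> tensors n"
  shows "rsym_D mul lact ract (Suc m) (rsym_D mul lact ract i c)
       = rsym_D mul lact ract i (rsym_D mul lact ract m c)"
proof (intro ext)
  fix n xs
  let ?D = "rsym_D mul lact ract"
  have m: "1 \<le> m" using im by simp
  consider "n = 0" | "n = Suc 0" | k where "n = Suc (Suc k)"
    by (metis not0_implies_Suc)
  then show "?D (Suc m) (?D i c) n xs = ?D i (?D m c) n xs"
  proof cases
    case 3
    show ?thesis
    proof (cases "m \<le> k \<and> length xs = n")
      case False
      then have "?D (Suc m) (?D i c) n xs = 0" using 3 by (auto simp: rsym_D_eq)
      moreover have "?D i (?D m c) n xs = 0"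
      proof (cases "length xs = n")
        case True
        with False have "?D m c (Suc k) = 0"
          using m by (auto simp: rsym_D_eq fun_eq_iff)
        then show ?thesis using 3 im by (simp add: rsym_D_eq)
      qed (use 3 im in \<open>auto simp: rsym_D_eq\<close>)
      ultimately show ?thesis by simp
    next
      case True
      define x y zs where "x = xs ! i" and "y = xs ! Suc m" and "zs = omit i (omit (Suc m) xs)"
      have len: "length xs = Suc (Suc k)" "length zs = k" "m \<le> k" "1 \<le> k"
        using True 3 im by (auto simp: zs_def)
      have zs: "zs = omit m (omit i xs)"
        using omit_omit[of i "Suc m" xs] im len by (simp add: zs_def)
      have D_i: "?D i c (Suc k) us = slot_action i (us ! i) (c k) (omit i us)"
        if "length us = Suc k" for us
        using that im len by (simp add: rsym_D_eq)
      have D_m: "?D m c (Suc k) us = slot_action m (us ! m) (c k) (omit m us)"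
        if "length us = Suc k" for us
        using that m len by (simp add: rsym_D_eq)
      have lhs: "?D (Suc m) (?D i c) n xs = slot_action m y (slot_action i x (c k)) zs"
      proof -
        have "head_action y (?D i c (Suc k)) (omit (Suc m) xs)
            = head_action y (slot_action i x (c k)) zs"
          using im len
          by (simp add: head_action_def D_i x_def zs_def omit_update_below nth_omit)
        moreover have "tail_action (Suc m) y (?D i c (Suc k)) (omit (Suc m) xs)
            = tail_action m y (slot_action i x (c k)) zs"
          unfolding tail_action_def
          using im len
          by (intro sum.reindex_bij_witness[of _ Suc "\<lambda>l. l - 1"])
             (auto simp: D_i x_def zs_def omit_update_above nth_omit)
        ultimately show ?thesis
          using 3 True by (simp add: rsym_D_eq slot_action_def y_def)
      qed
      have rhs: "?D i (?D m c) n xs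
          = slot_action i x (slot_action m y (c k)) zs + slot_action m (br x y) (c k) zs"
      proof -
        have "head_action x (?D m c (Suc k)) (omit i xs)
            = head_action x (slot_action m y (c k)) zs"
          using im len
          by (simp add: head_action_def D_m y_def zs omit_update_below nth_omit)
        moreover have "tail_action i x (?D m c (Suc k)) (omit i xs)
            = tail_action i x (slot_action m y (c k)) zs + slot_action m (br x y) (c k) zs"
        proof -
          let ?t = "\<lambda>l. ?D m c (Suc k) ((omit i xs)[l := br x (omit i xs ! l)])"
          let ?s = "\<lambda>l. slot_action m y (c k) (zs[l := br x (zs ! l)])"
          (* The slot m holds y; the slots before and after it survive the second deletion. *)
          have "tail_action i x (?D m c (Suc k)) (omit i xs) = sum ?t {i..<Suc k}"
            using im len by (simp add: tail_action_def)
          also have "{i..<Suc k} = insert m ({i..<m} \<union> {Suc m..<Suc k})"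
            using im len by auto
          also have "sum ?t \<dots> = ?t m + (sum ?t {i..<m} + sum ?t {Suc m..<Suc k})"
          proof -
            have "sum ?t ({i..<m} \<union> {Suc m..<Suc k}) = sum ?t {i..<m} + sum ?t {Suc m..<Suc k}"
              by (rule sum.union_disjoint) auto
            then show ?thesis by (subst sum.insert) auto
          qed
          also have "?t m = slot_action m (br x y) (c k) zs"
            using im len by (simp add: D_m omit_update_same zs y_def nth_omit)
          also have "sum ?t {i..<m} = sum ?s {i..<m}"
            using im len
            by (intro sum.cong refl) (auto simp: D_m zs omit_update_below nth_omit y_def)
          also have "sum ?t {Suc m..<Suc k} = sum ?s {m..<k}"
            using im len
            by (intro sum.reindex_bij_witness[of _ Suc "\<lambda>l. l - 1"])
               (auto simp: D_m zs omit_update_above nth_omit y_def)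
          also have "sum ?s {i..<m} + sum ?s {m..<k} = sum ?s {i..<k}"
            using im len by (intro sum.atLeastLessThan_concat) auto
          finally show ?thesis using len by (simp add: tail_action_def add.commute)
        qed
        ultimately show ?thesis
          using 3 True im
          by (simp add: rsym_D_eq slot_action_def x_def)
      qed
      show ?thesis
        unfolding lhs rhs by (rule slot_action_commutator[OF c[OF len(4)] len(2,4) im])
    qed
  next
    case 1
    then show ?thesis by simp
  next
    case 2
    have "?D j b (Suc 0) xs = 0" if "1 \<le> j" for j b
      using that rsym_D_eq[of j b 0 xs] by simp
    then show ?thesis using 2 im by simp
  qed
qed

section \<open>Multilinearity\<close>

lemma slot_action_linear_parameter:
  assumes "\<psi> \<in> tensors n" "length ys = n" "1 \<le> n"
  shows "Vector_Spaces.linear scaleA scaleM (\<lambda>x. slot_action i x \<psi> ys)"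
proof -
  note lin = tensors_linear[OF assms(1,2)]
  show ?thesis
    unfolding slot_action_def head_action_def tail_action_def
    using assms(2,3)
    by (intro AM.linear_compose_add AM.linear_compose_sub AM.linear_compose_sum ballI
        linear_comp[OF lin lact_linear_right] ract_linear_right
        linear_comp[OF mul_linear_right lin] linear_comp[OF linear_br_left lin]) auto
qed

lemma slot_action_tensors:
  assumes \<psi>: "\<psi> \<in> tensors n" and i: "1 \<le> i"
  shows "slot_action i x \<psi> \<in> tensors n"
proof -
  have "Vector_Spaces.linear scaleA scaleM (\<lambda>v. slot_action i x \<psi> (ys[p := v]))"
    if ys: "length ys = n" and p: "p < n" for ys p
  proof -
    note lin = tensors_linear[OF \<psi>]
    have "Vector_Spaces.linear scaleA scaleM (\<lambda>v. head_action x \<psi> (ys[p := v]))"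
    proof (cases "p = 0")
      case True
      then show ?thesis
        unfolding head_action_def
        using ys p
        by (simp, intro AM.linear_compose_add AM.linear_compose_sub lact_linear_left
            linear_comp[OF mul_linear_left lin] linear_comp[OF lin ract_linear_left]) auto
    next
      case False
      then show ?thesis
        unfolding head_action_def
        using ys p
        by (simp add: list_update_swap[of p 0], intro AM.linear_compose_add AM.linear_compose_sub
            linear_comp[OF lin lact_linear_right] lin linear_comp[OF lin ract_linear_left]) auto
    qed
    moreover have "Vector_Spaces.linear scaleA scaleM
        (\<lambda>v. \<psi> (ys[p := v, l := br x (ys[p := v] ! l)]))" if "l < n" for l
    proof (cases "l = p")
      case True
      then show ?thesis
        using ys p linear_comp[OF linear_br_right lin] by simp
    next
      case False
      then show ?thesis
        using ys p lin by (simp add: list_update_swap[of p l])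
    qed
    ultimately show ?thesis
      unfolding slot_action_def tail_action_def length_list_update
      using ys by (intro AM.linear_compose_add AM.linear_compose_sum) auto
  qed
  moreover have "slot_action i x \<psi> ys = 0" if "length ys \<noteq> n" for ys
    using that tensors_outside[OF \<psi>]
    by (simp add: slot_action_def head_action_def tail_action_def lact_zero ract_zero)
  ultimately show ?thesis by (simp add: tensor_cochains_def)
qed

lemma tensors_zero: "0 \<in> tensors n"
  by (simp add: tensor_cochains_def AM.linear_zero)

lemma tensors_scale_sum:
  assumes "\<And>i. i \<in> I \<Longrightarrow> f i \<in> tensors n"
  shows "(\<lambda>xs. - (\<Sum>i\<in>I. scaleM (r i) (f i xs))) \<in> tensors n"
  using assms
  by (auto simp: tensor_cochains_def M.scale_zero_right
      intro!: AM.linear_compose_neg AM.linear_compose_sum AM.linear_compose_scale_right)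

text \<open>
  The argument \<open>a\<^sub>i\<close> enters as the parameter of the slot action and all others as entries of
  the shortened list, so linearity in the parameter and in the slots together give linearity in
  every argument.
\<close>

lemma rsym_D_tensors:
  assumes i: "1 \<le> i" and c: "1 \<le> k \<Longrightarrow> c k \<in> tensors k"
  shows "rsym_D mul lact ract i c (Suc k) \<in> tensors (Suc k)"
proof (cases "i \<le> k")
  case False
  with i have "rsym_D mul lact ract i c (Suc k) = 0"
    by (auto simp: rsym_D_eq fun_eq_iff)
  then show ?thesis by (simp add: tensors_zero)
next
  case True
  with i have k: "1 \<le> k" by simp
  have "Vector_Spaces.linear scaleA scaleM (\<lambda>v. rsym_D mul lact ract i c (Suc k) (xs[p := v]))"
    if xs: "length xs = Suc k" and p: "p < Suc k" for xs p
  proof -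
    consider "p < i" | "p = i" | "i < p" by linarith
    then show ?thesis
    proof cases
      case 1
      then show ?thesis
        using True xs i tensors_linear[OF slot_action_tensors[OF c[OF k] i], of "omit i xs" p "xs ! i"]
        by (simp add: rsym_D_eq omit_update_below)
    next
      case 2
      then show ?thesis
        using True xs i slot_action_linear_parameter[OF c[OF k] _ k, of "omit i xs" i]
        by (simp add: rsym_D_eq omit_update_same)
    next
      case 3
      then show ?thesis
        using True xs i p
          tensors_linear[OF slot_action_tensors[OF c[OF k] i], of "omit i xs" "p - 1" "xs ! i"]
        by (simp add: rsym_D_eq omit_update_above)
    qed
  qed
  moreover have "rsym_D mul lact ract i c (Suc k) xs = 0" if "length xs \<noteq> Suc k" for xs
    using that i by (simp add: rsym_D_eq)
  ultimately show ?thesis by (simp add: tensor_cochains_def)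
qed

section \<open>Skew-symmetry of the coboundary\<close>

lemma alternating_tensors: "\<psi> \<in> alternating n \<Longrightarrow> \<psi> \<in> tensors n"
  by (simp add: rsym_cochains_def)

lemma alternating_eq_0:
  "\<psi> \<in> alternating n \<Longrightarrow> length xs = n \<Longrightarrow> 1 \<le> p \<Longrightarrow> p < q \<Longrightarrow> q < n \<Longrightarrow> xs ! p = xs ! q
     \<Longrightarrow> \<psi> xs = 0"
  unfolding rsym_cochains_def by blast

text \<open>Polarization: expand the value with \<open>a + b\<close> in both slots.\<close>

lemma skew_of_alternating:
  assumes \<psi>: "\<psi> \<in> tensors n" and "length xs = n" "p < n" "q < n" "p \<noteq> q"
    and diag: "\<And>u. \<psi> (xs[p := u, q := u]) = 0"
  shows "\<psi> (xs[p := a, q := b]) + \<psi> (xs[p := b, q := a]) = 0"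
proof -
  let ?G = "\<lambda>u v. \<psi> (xs[p := u, q := v])"
  have right: "?G u (v + w) = ?G u v + ?G u w" for u v w
    using AM.linear_add[OF tensors_linear[OF \<psi>, of "xs[p := u]" q]] assms by simp
  have left: "?G (v + w) u = ?G v u + ?G w u" for u v w
    using AM.linear_add[OF tensors_linear[OF \<psi>, of "xs[q := u]" p]] assms
    by (simp add: list_update_swap[of p q])
  have "0 = ?G (a + b) (a + b)" by (simp only: diag)
  also have "\<dots> = ?G a b + ?G b a"
    by (simp only: left right) (simp add: diag)
  finally show ?thesis by (rule sym)
qed

text \<open>
  Vanishing on equal neighbours makes \<open>\<psi>\<close> change sign when neighbours are exchanged, and such
  exchanges bring two equal arguments next to each other.
\<close>

lemma alternating_if_adjacent:
  assumes \<psi>: "\<psi> \<in> tensors n"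
    and adj: "\<And>xs p. length xs = n \<Longrightarrow> 1 \<le> p \<Longrightarrow> Suc p < n \<Longrightarrow> xs ! p = xs ! Suc p \<Longrightarrow> \<psi> xs = 0"
  shows "\<psi> \<in> alternating n"
proof -
  have "\<psi> xs = 0"
    if "length xs = n" "1 \<le> p" "Suc (p + r) < n" "xs ! p = xs ! Suc (p + r)" for xs p r
    using that
  proof (induction r arbitrary: xs)
    case 0
    then show ?case using adj by simp
  next
    case (Suc r)
    let ?q = "Suc (p + r)"
    let ?ys = "xs[?q := xs ! Suc ?q, Suc ?q := xs ! ?q]"
    have "\<psi> ?ys = 0"
      using Suc.prems by (intro Suc.IH) auto
    moreover have "\<psi> ?ys + \<psi> (xs[?q := xs ! ?q, Suc ?q := xs ! Suc ?q]) = 0"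
      using Suc.prems by (intro skew_of_alternating[OF \<psi>] adj[of _ ?q]) auto
    ultimately show ?case by simp
  qed
  then have "\<psi> xs = 0" if "length xs = n" "1 \<le> p" "p < q" "q < n" "xs ! p = xs ! q" for xs p q
    using that less_imp_Suc_add[OF \<open>p < q\<close>] by auto
  with \<psi> show ?thesis by (auto simp: rsym_cochains_def)
qed

text \<open>
  Only the tail terms at \<open>q\<close> and \<open>q + 1\<close> separate the two equal entries. If the tail contains
  both of them, their sum vanishes by skew-symmetry. The excluded case \<open>i = q + 1\<close> is the one in
  which it contains just one.
\<close>

lemma slot_action_adjacent_eq_0:
  assumes \<psi>: "\<psi> \<in> alternating n" and ys: "length ys = n"
    and q: "1 \<le> q" "Suc q < n" "ys ! q = ys ! Suc q"
    and i: "1 \<le> i" "i \<le> q \<or> Suc q < i"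
  shows "slot_action i x \<psi> ys = 0"
proof -
  have zero: "\<psi> (ys[l := v]) = 0" if "l \<noteq> q" "l \<noteq> Suc q" for l v
    using that q ys by (intro alternating_eq_0[OF \<psi>, of _ q "Suc q"]) auto
  have "head_action x \<psi> ys = 0"
    using zero[of 0] zero[of 0 "ys ! 0"] q by (simp add: head_action_def lact_zero ract_zero)
  moreover have "tail_action i x \<psi> ys = 0"
  proof (cases "i \<le> q")
    case True
    have "tail_action i x \<psi> ys = (\<Sum>l\<in>{q, Suc q}. \<psi> (ys[l := br x (ys ! l)]))"
      unfolding tail_action_def
      using True ys q zero by (intro sum.mono_neutral_right) auto
    also have "\<dots> = \<psi> (ys[q := br x (ys ! q), Suc q := ys ! q])
        + \<psi> (ys[q := ys ! q, Suc q := br x (ys ! q)])"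
    proof -
      have "ys[q := u, Suc q := ys ! q] = ys[q := u]" for u
        by (metis list_update_id n_not_Suc_n nth_list_update_neq q(3))
      then show ?thesis by (simp flip: q(3))
    qed
    also have "\<dots> = 0"
      using q ys
      by (intro skew_of_alternating[OF alternating_tensors[OF \<psi>]]
          alternating_eq_0[OF \<psi>, of _ q "Suc q"]) auto
    finally show ?thesis .
  next
    case False
    then show ?thesis
      unfolding tail_action_def using i zero by (intro sum.neutral) auto
  qed
  ultimately show ?thesis by (simp add: slot_action_def)
qed

text \<open>The tails differ by the term at \<open>p\<close>, in which the slot \<open>p\<close> holds \<open>[x, x] = 0\<close>.\<close>

lemma tail_action_Suc:
  assumes "\<psi> \<in> tensors (length ys)" "p < length ys"
  shows "tail_action p (ys ! p) \<psi> ys = tail_action (Suc p) (ys ! p) \<psi> ys"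
  using assms AM.linear_0[OF tensors_linear[OF assms(1) refl assms(2)]]
  by (simp add: tail_action_def sum.atLeast_Suc_lessThan)

text \<open>
  Deleting either one of two equal neighbours \<open>a\<^sub>p = a\<^sub>p\<^sub>+\<^sub>1\<close> leaves the same list, so \<open>D\<^sub>p\<close> and
  \<open>D\<^sub>p\<^sub>+\<^sub>1\<close> take the same value. All other \<open>D\<^sub>i\<close> leave the two neighbours in place, next to
  each other and on the same side of \<open>i\<close>, and vanish.
\<close>

lemma rsym_d_alternating:
  assumes c: "1 \<le> k \<Longrightarrow> c k \<in> alternating k"
  shows "rsym_d scaleM mul lact ract c (Suc k) \<in> alternating (Suc k)"
proof (rule alternating_if_adjacent)
  let ?D = "rsym_D mul lact ract"
  show "rsym_d scaleM mul lact ract c (Suc k) \<in> tensors (Suc k)"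
    unfolding rsym_d_def[abs_def]
    by (intro tensors_scale_sum rsym_D_tensors alternating_tensors c) auto
  fix xs :: "'a list" and p
  assume xs: "length xs = Suc k" and p: "1 \<le> p" "Suc p < Suc k" "xs ! p = xs ! Suc p"
  then have k: "1 \<le> k" by simp
  note \<psi> = c[OF k]
  have zero: "?D i c (Suc k) xs = 0" if "i \<in> {1..<Suc k} - {p, Suc p}" for i
  proof (cases "i < p")
    case True
    then have "slot_action i (xs ! i) (c k) (omit i xs) = 0"
      using that xs p by (intro slot_action_adjacent_eq_0[OF \<psi>, of _ "p - 1"]) (auto simp: nth_omit)
    with that show ?thesis by (simp add: rsym_D_eq)
  next
    case False
    then have "slot_action i (xs ! i) (c k) (omit i xs) = 0"
      using that xs p by (intro slot_action_adjacent_eq_0[OF \<psi>, of _ p]) (auto simp: nth_omit)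
    with that show ?thesis by (simp add: rsym_D_eq)
  qed
  have "xs ! p = omit p xs ! p"
    using xs p by (simp add: nth_omit)
  then have "tail_action p (xs ! p) (c k) (omit p xs) = tail_action (Suc p) (xs ! p) (c k) (omit p xs)"
    using tail_action_Suc[of "c k" "omit p xs" p] alternating_tensors[OF \<psi>] xs p by simp
  then have same: "?D (Suc p) c (Suc k) xs = ?D p c (Suc k) xs"
    using xs p omit_adjacent_eq[of p xs] by (simp add: rsym_D_eq slot_action_def)
  have "(\<Sum>i\<in>{1..<Suc k}. scaleM ((-1) ^ i) (?D i c (Suc k) xs))
      = (\<Sum>i\<in>{p, Suc p}. scaleM ((-1) ^ i) (?D i c (Suc k) xs))"
    using zero p by (intro sum.mono_neutral_right) auto
  also have "\<dots> = 0" by (simp add: same)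
  finally show "rsym_d scaleM mul lact ract c (Suc k) xs = 0"
    by (simp add: rsym_d_def)
qed

section \<open>The operators on families and the square of the coboundary\<close>

lemma vector_space_families: "vector_space (scale_family scaleM)"
  by standard (auto simp: scale_family_def fun_eq_iff M.scale_right_distrib M.scale_left_distrib)

lemma rsym_D_linear:
  "Vector_Spaces.linear (scale_family scaleM) (scale_family scaleM) (rsym_D mul lact ract i)"
proof -
  interpret F: vector_space "scale_family scaleM" by (rule vector_space_families)
  interpret FF: vector_space_pair "scale_family scaleM" "scale_family scaleM" by unfold_locales
  show ?thesis
    unfolding Vector_Spaces.linear_iff
    by (auto simp: rsym_D_def fun_eq_iff scale_family_def lact_add ract_add lact_scale ract_scale
        sum.distrib M.scale_right_distrib M.scale_right_diff_distrib M.scale_sum_right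
        F.vector_space_axioms split: nat.split)
qed

text \<open>
  The number of summands of the coboundary grows with the degree, so it is not one finite linear
  combination of the operators \<open>D\<^sub>i\<close>; degree by degree it agrees with one, which is what lets a
  further \<open>D\<^sub>j\<close> pass through it by linearity.
\<close>

lemma rsym_d_eq_sum_families:
  "rsym_d scaleM mul lact ract c n
     = (- (\<Sum>i\<in>{1..<n}. scale_family scaleM ((-1) ^ i) (rsym_D mul lact ract i c))) n"
  by (simp add: rsym_d_def fun_eq_iff sum_fun_apply scale_family_def)

lemma rsym_d_linear:
  "Vector_Spaces.linear (scale_family scaleM) (scale_family scaleM) (rsym_d scaleM mul lact ract)"
proof -
  interpret F: vector_space "scale_family scaleM" by (rule vector_space_families)
  note lin = rsym_D_linear[unfolded Vector_Spaces.linear_iff]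
  show ?thesis
    unfolding Vector_Spaces.linear_iff
    using lin
    by (auto simp: rsym_d_def fun_eq_iff scale_family_def sum.distrib M.scale_right_distrib
        M.scale_sum_right mult.commute F.vector_space_axioms)
qed

text \<open>
  The terms with \<open>i < j\<close> correspond to those with \<open>j \<le> i\<close> by \<open>(j, i) \<mapsto> (i, j - 1)\<close>; the
  pre-simplicial relation identifies the values, and the signs are opposite.
\<close>

lemma presimplicial_alternating_sum:
  assumes "\<And>i m. 1 \<le> i \<Longrightarrow> i \<le> m \<Longrightarrow> F (Suc m) i = F i m"
  shows "(\<Sum>j\<in>{1..<Suc k}. \<Sum>i\<in>{1..<k}. scaleM ((-1) ^ (j + i)) (F j i)) = 0"
proof -
  let ?g = "\<lambda>(j, i). scaleM ((-1) ^ (j + i)) (F j i)"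
  let ?P = "{1..<Suc k} \<times> {1..<k}"
  let ?L = "{(j, i). (j, i) \<in> ?P \<and> i < j}" and ?U = "{(j, i). (j, i) \<in> ?P \<and> j \<le> i}"
  have fin: "finite ?L" "finite ?U"
    by (rule finite_subset[of _ ?P]; auto)+
  have "sum ?g ?L = (\<Sum>p\<in>?U. - ?g p)"
    by (rule sum.reindex_bij_witness[of _ "\<lambda>(j, i). (Suc i, j)" "\<lambda>(j, i). (i, j - 1)"])
       (use assms in \<open>auto dest!: less_imp_Suc_add simp: add.commute\<close>)
  moreover have "sum ?g (?L \<union> ?U) = sum ?g ?L + sum ?g ?U"
    using fin by (intro sum.union_disjoint) auto
  moreover have "?L \<union> ?U = ?P" by auto
  ultimately have "sum ?g ?P = 0"
    by (simp only: sum_negf add.left_inverse)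
  then show ?thesis
    by (simp only: sum.cartesian_product)
qed

lemma rsym_d_squared:
  assumes c: "\<And>n. 1 \<le> n \<Longrightarrow> c n \<in> tensors n"
  shows "rsym_d scaleM mul lact ract (rsym_d scaleM mul lact ract c) = 0"
proof (intro ext)
  fix n xs
  let ?D = "rsym_D mul lact ract" and ?d = "rsym_d scaleM mul lact ract"
  interpret F: vector_space "scale_family scaleM" by (rule vector_space_families)
  interpret FF: vector_space_pair "scale_family scaleM" "scale_family scaleM" by unfold_locales
  show "?d (?d c) n xs = 0 n xs"
  proof (cases n)
    case 0
    then show ?thesis by (simp add: rsym_d_def)
  next
    case (Suc k)
    let ?s = "\<Sum>i\<in>{1..<k}. scale_family scaleM ((-1) ^ i) (?D i c)"
    have "?D j (?d c) n xs = - (\<Sum>i\<in>{1..<k}. scaleM ((-1) ^ i) (?D j (?D i c) n xs))" for j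
    proof -
      have "?D j (?d c) n = ?D j (- ?s) n"
        using rsym_d_eq_sum_families[of c k] Suc by (simp add: rsym_D_def fun_eq_iff)
      also have "?D j (- ?s) = - (\<Sum>i\<in>{1..<k}. scale_family scaleM ((-1) ^ i) (?D j (?D i c)))"
        by (simp only: FF.linear_neg[OF rsym_D_linear] FF.linear_sum[OF rsym_D_linear]
            FF.linear_scale[OF rsym_D_linear])
      finally show ?thesis by (simp add: sum_fun_apply scale_family_def)
    qed
    then have "?d (?d c) n xs
        = (\<Sum>j\<in>{1..<Suc k}. \<Sum>i\<in>{1..<k}. scaleM ((-1) ^ (j + i)) (?D j (?D i c) n xs))"
      using Suc by (simp add: rsym_d_def[of _ _ _ _ "?d c"] M.scale_sum_right power_add sum_negf)
    also have "\<dots> = 0"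
      by (rule presimplicial_alternating_sum) (simp add: rsym_D_commute c)
    finally show ?thesis by simp
  qed
qed

end

section \<open>The pre-simplicial cochain complex\<close>

theorem theorem3p1:
  fixes scaleA :: "'k::field \<Rightarrow> 'a::ab_group_add \<Rightarrow> 'a"
    and scaleM :: "'k \<Rightarrow> 'm::ab_group_add \<Rightarrow> 'm"
    and mul :: "'a \<Rightarrow> 'a \<Rightarrow> 'a"
    and lact :: "'a \<Rightarrow> 'm \<Rightarrow> 'm"
    and ract :: "'m \<Rightarrow> 'a \<Rightarrow> 'm"
  defines "D \<equiv> rsym_D mul lact ract"
    and "d \<equiv> rsym_d scaleM mul lact ract"
    and "T \<equiv> tensor_cochains scaleA scaleM"
    and "C \<equiv> rsym_cochains scaleA scaleM"
  assumes "right_symmetric_module scaleA mul scaleM lact ract"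
  shows "(\<forall>i\<ge>1. Vector_Spaces.linear (scale_family scaleM) (scale_family scaleM) (D i) \<and>
            D i ` direct_sum T \<subseteq> direct_sum T \<and>
            (\<forall>k\<ge>1. D i ` homogeneous T k \<subseteq> homogeneous T (Suc k))) \<and>
         direct_sum C \<subseteq> direct_sum T \<and>
         (\<forall>i j. 1 \<le> i \<and> i < j \<longrightarrow>
            (\<forall>c\<in>direct_sum T. D j (D i c) = D i (D (j - 1) c))) \<and>
         Vector_Spaces.linear (scale_family scaleM) (scale_family scaleM) d \<and>
         d ` direct_sum C \<subseteq> direct_sum C \<and>
         (\<forall>k\<ge>1. d ` homogeneous C k \<subseteq> homogeneous C (Suc k)) \<and>
         (\<forall>c\<in>direct_sum C. d (d c) = 0)"
proof -
  interpret right_symmetric_module scaleA mul scaleM lact ract by fact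
  have C_T: "C n \<subseteq> T n" for n
    by (auto simp: C_def T_def alternating_tensors)
  have D_zero: "D i c (Suc k) = 0" if "c k = 0" for i c k
    using that by (auto simp: D_def rsym_D_def fun_eq_iff lact_zero ract_zero)
  have d_zero: "d c (Suc k) = 0" if "c k = 0" for c k
    using D_zero[of c k, OF that] by (simp add: d_def D_def rsym_d_def fun_eq_iff)
  have d_0: "d c 0 = 0" for c
    by (simp add: d_def rsym_d_def fun_eq_iff)
  (* Preserving the direct sum and raising homogeneous degree by one are common to all D i and d:
     both follow from the behaviour of an operator in each single degree. *)
  have raise: "f ` direct_sum X \<subseteq> direct_sum X \<and>
      (\<forall>k\<ge>1. f ` homogeneous X k \<subseteq> homogeneous X (Suc k))"
    if f0: "\<And>c. f c 0 = 0" and fz: "\<And>c k. c k = 0 \<Longrightarrow> f c (Suc k) = 0"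
      and fX: "\<And>c k. (1 \<le> k \<Longrightarrow> c k \<in> X k) \<Longrightarrow> f c (Suc k) \<in> X (Suc k)"
    for f :: "(nat \<Rightarrow> 'a list \<Rightarrow> 'm) \<Rightarrow> nat \<Rightarrow> 'a list \<Rightarrow> 'm" and X
  proof (intro conjI allI impI subsetI)
    fix c' assume "c' \<in> f ` direct_sum X"
    then obtain c where c': "c' = f c" and c: "c \<in> direct_sum X" by blast
    have "f c n \<in> X n" if "1 \<le> n" for n
      using that fX[of "n - 1" c] c by (cases n) (auto simp: direct_sum_def)
    moreover have "{n. f c n \<noteq> 0} \<subseteq> Suc ` {n. c n \<noteq> 0}"
    proof
      fix n assume "n \<in> {n. f c n \<noteq> 0}"
      then show "n \<in> Suc ` {n. c n \<noteq> 0}"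
        using f0 fz by (cases n) auto
    qed
    then have "finite {n. f c n \<noteq> 0}"
      using c by (auto simp: direct_sum_def intro: finite_subset)
    ultimately show "c' \<in> direct_sum X"
      by (simp add: c' direct_sum_def f0)
  next
    fix k :: nat and c' assume "1 \<le> k" "c' \<in> f ` homogeneous X k"
    then obtain c where c': "c' = f c" and c: "c \<in> homogeneous X k" by blast
    have "f c n = 0" if "n \<noteq> Suc k" for n
      using that c f0 fz by (cases n) (auto simp: homogeneous_def)
    moreover have "f c (Suc k) \<in> X (Suc k)"
      using c by (intro fX) (simp add: homogeneous_def)
    ultimately show "c' \<in> homogeneous X (Suc k)"
      by (simp add: c' homogeneous_def)
  qed
  have D_raise: "D i ` direct_sum T \<subseteq> direct_sum T \<and>
      (\<forall>k\<ge>1. D i ` homogeneous T k \<subseteq> homogeneous T (Suc k))" if "1 \<le> i" for i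
    by (rule raise) (use that D_zero in \<open>auto simp: D_def T_def intro: rsym_D_tensors\<close>)
  have d_raise: "d ` direct_sum C \<subseteq> direct_sum C \<and>
      (\<forall>k\<ge>1. d ` homogeneous C k \<subseteq> homogeneous C (Suc k))"
    by (rule raise) (use d_0 d_zero in \<open>auto simp: d_def C_def intro: rsym_d_alternating\<close>)
  have sub: "direct_sum C \<subseteq> direct_sum T"
    using C_T by (auto simp: direct_sum_def)
  have comm: "D j (D i c) = D i (D (j - 1) c)" if "1 \<le> i" "i < j" "c \<in> direct_sum T" for i j c
    using that rsym_D_commute[of i "j - 1" c] by (simp add: D_def T_def direct_sum_def)
  have sq: "d (d c) = 0" if "c \<in> direct_sum C" for c
    using that sub rsym_d_squared[of c] by (auto simp: d_def T_def direct_sum_def)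
  have lin: "Vector_Spaces.linear (scale_family scaleM) (scale_family scaleM) (D i)"
      "Vector_Spaces.linear (scale_family scaleM) (scale_family scaleM) d" for i
    unfolding D_def d_def by (rule rsym_D_linear rsym_d_linear)+
  show ?thesis
    by (intro conjI allI impI ballI lin sub comm sq D_raise[THEN conjunct1]
        D_raise[THEN conjunct2, rule_format] d_raise[THEN conjunct1]
        d_raise[THEN conjunct2, rule_format]) auto
qed

end
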